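(* Let $G$ be an infinite, connected, countable, locally finite $d$-regular graph. For any starting vertex and any initial port, the random basic walk on $G$ cycles with probability $1$.
   Context: Each undirected edge $\{v,w\}$ is regarded as two arcs $v\to w$ and $w\to v$. A labeling assigns, at each vertex $v$ of degree $\deg(v)$, the port numbers $1,\dots,\deg(v)$ bijectively to the arcs leaving $v$ (labels on $v\to w$ and $w\to v$ need not agree). In a random labeling these bijections are chosen uniformly at random, independently for different vertices. Given a labeling, a starting vertex $v_0$ and an initial port $\ell$, the basic walk leaves $v_0$ along the arc labeled $\ell$; thereafter, whenever it enters a vertex $v$ along an arc whose label is $i$, it leaves $v$ along the arc out of $v$ labeled $(i \bmod \deg(v))+1$. The random basic walk is the basic walk for a random labeling. The walk cycles if some arc is traversed twice in the same direction (equivalently, from some point on it is periodic and visits only finitely many vertices); it is transient otherwise. *)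

theory Defs
  imports "HOL-Probability.Probability"
begin

text \<open>Graphs: a symmetric irreflexive adjacency relation E on the vertex type.
  Arcs are ordered pairs (v,w) with E v w.  A labeling sigma assigns at each
  vertex v a bijection sigma v from the ports 1..deg v onto the neighbours of v;
  sigma v i is the head of the arc leaving v with label i.\<close>

definition nbrs :: "('a \<Rightarrow> 'a \<Rightarrow> bool) \<Rightarrow> 'a \<Rightarrow> 'a set" where
  "nbrs E v = {w. E v w}"

definition deg :: "('a \<Rightarrow> 'a \<Rightarrow> bool) \<Rightarrow> 'a \<Rightarrow> nat" where
  "deg E v = card (nbrs E v)"

text \<open>Possible port assignments at vertex v (extensional outside 1..deg v,
  so that the set is finite).\<close>
definition labelings_at :: "('a \<Rightarrow> 'a \<Rightarrow> bool) \<Rightarrow> 'a \<Rightarrow> (nat \<Rightarrow> 'a) set" where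
  "labelings_at E v =
     {f \<in> {1..deg E v} \<rightarrow>\<^sub>E nbrs E v. bij_betw f {1..deg E v} (nbrs E v)}"

definition arc_label :: "('a \<Rightarrow> 'a \<Rightarrow> bool) \<Rightarrow> ('a \<Rightarrow> nat \<Rightarrow> 'a) \<Rightarrow> 'a \<Rightarrow> 'a \<Rightarrow> nat" where
  "arc_label E \<sigma> u w = inv_into {1..deg E u} (\<sigma> u) w"

fun basic_walk :: "('a \<Rightarrow> 'a \<Rightarrow> bool) \<Rightarrow> ('a \<Rightarrow> nat \<Rightarrow> 'a) \<Rightarrow> 'a \<Rightarrow> nat \<Rightarrow> nat \<Rightarrow> 'a \<times> 'a" where
  "basic_walk E \<sigma> v0 l 0 = (v0, \<sigma> v0 l)"
| "basic_walk E \<sigma> v0 l (Suc n) =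
     (let (u, v) = basic_walk E \<sigma> v0 l n;
          i = arc_label E \<sigma> u v
      in (v, \<sigma> v (i mod deg E v + 1)))"

definition walk_cycles :: "('a \<Rightarrow> 'a \<Rightarrow> bool) \<Rightarrow> ('a \<Rightarrow> nat \<Rightarrow> 'a) \<Rightarrow> 'a \<Rightarrow> nat \<Rightarrow> bool" where
  "walk_cycles E \<sigma> v0 l \<longleftrightarrow> (\<exists>m n. m < n \<and> basic_walk E \<sigma> v0 l m = basic_walk E \<sigma> v0 l n)"

definition random_labeling :: "('a \<Rightarrow> 'a \<Rightarrow> bool) \<Rightarrow> ('a \<Rightarrow> nat \<Rightarrow> 'a) measure" where
  "random_labeling E = (\<Pi>\<^sub>M v\<in>UNIV. measure_pmf (pmf_of_set (labelings_at E v)))"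

end

theory Submission
  imports Defs
begin

text \<open>In a \<open>d\<close>-regular graph the port used at time \<open>k\<close> is deterministic, so the walk cycles as
  soon as a pair (vertex, port) repeats. Suppose the walk enters a vertex \<open>x\<close> for the first time,
  from \<open>y\<close> through port \<open>q\<close>. Let it oscillate \<open>x, w, x, w', x, \<dots>\<close> through new targets of \<open>x\<close>
  other than \<open>y\<close>, until port \<open>q - 1\<close> comes up at \<open>x\<close>, and then let it go to \<open>y\<close>: this repeats the
  pair \<open>(y, q)\<close>. Every step is either free, hence taken with conditional probability at least
  \<open>1/d\<close>, or already determined, in which case a pair has been repeated anyway; at most \<open>2d\<close> steps
  are needed. So a first visit at time \<open>n\<close>, with no earlier repetition, has probability at most \<open>d\<^sup>2\<^sup>d\<close> times the probability
  that the first repetition falls in \<open>(n, n + 2d]\<close>. These bounds are summable, and by Borel-Cantelli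
  there are almost surely finitely many first visits without a repetition, whereas a transient
  walk makes infinitely many.\<close>

text \<open>The partial sums telescope to the first \<open>m\<close> terms minus \<open>m\<close>
  terms at the far end, and the latter are nonnegative.\<close>

lemma summable_diff_shift:
  fixes a :: "nat \<Rightarrow> real"
  assumes "decseq a" "\<And>n. 0 \<le> a n"
  shows "summable (\<lambda>n. a n - a (n + m))"
proof (rule summableI_nonneg_bounded)
  show "0 \<le> a n - a (n + m)" for n
    using decseqD[OF assms(1), of n "n + m"] by simp
  show "(\<Sum>n<N. a n - a (n + m)) \<le> (\<Sum>n<m. a n)" for N
  proof -
    have "(\<Sum>n<N + m. a n) = (\<Sum>n<m. a n) + (\<Sum>n<N. a (n + m))"
      by (induction N) auto
    moreover have "(\<Sum>n<N. a n) \<le> (\<Sum>n<N + m. a n)"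
      using assms(2) by (intro sum_mono2) auto
    ultimately show ?thesis by (simp add: sum_subtractf)
  qed
qed

locale regular_graph_walk =
  fixes E :: "'a::countable \<Rightarrow> 'a \<Rightarrow> bool" and d :: nat and v0 :: 'a and l :: nat
  assumes sym: "\<And>v w. E v w \<Longrightarrow> E w v"
    and irrefl: "\<And>v. \<not> E v v"
    and locally_finite: "\<And>v. finite (nbrs E v)"
    and regular: "\<And>v. deg E v = d"
    and port: "l \<in> {1..d}"
begin

section \<open>The walk driven by a time-determined port\<close>

text \<open>By regularity the rule \<open>i mod d + 1\<close> is a cyclic shift independent of the
  vertex; \<open>l - 1\<close> passes to residues starting at 0.\<close>

definition port_at :: "nat \<Rightarrow> nat" where
  "port_at k = (l - 1 + k) mod d + 1"

primrec pos :: "('a \<Rightarrow> nat \<Rightarrow> 'a) \<Rightarrow> nat \<Rightarrow> 'a" where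
  "pos \<sigma> 0 = v0"
| "pos \<sigma> (Suc n) = \<sigma> (pos \<sigma> n) (port_at n)"

text \<open>The last entry counts too, with the port through which it is about to be left. So the
  step after \<open>xs\<close> leaves through a port not yet used at that vertex.\<close>

definition no_repeat :: "'a list \<Rightarrow> bool" where
  "no_repeat xs \<longleftrightarrow> inj_on (\<lambda>k. (xs ! k, port_at k)) {..<length xs}"

definition history :: "('a \<Rightarrow> nat \<Rightarrow> 'a) \<Rightarrow> nat \<Rightarrow> 'a list" where
  "history \<sigma> n = map (pos \<sigma>) [0..<Suc n]"

definition cyl :: "'a list \<Rightarrow> ('a \<Rightarrow> nat \<Rightarrow> 'a) set" where
  "cyl xs = {\<sigma>. \<forall>k<length xs. pos \<sigma> k = xs ! k}"

lemma d_pos: "d > 0"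
  using port by simp

lemma port_at_range: "port_at k \<in> {1..d}"
  using d_pos by (simp add: port_at_def Suc_le_eq)

lemma port_at_0: "port_at 0 = l"
  unfolding port_at_def using port by auto

lemma port_at_Suc: "port_at (Suc k) = port_at k mod d + 1"
  by (simp add: port_at_def mod_Suc_eq)

lemma port_at_add_d: "port_at (k + d) = port_at k"
  by (simp add: port_at_def flip: add.assoc)

section \<open>Random labelings and measurability\<close>

lemma finite_labelings: "finite (labelings_at E v)"
  unfolding labelings_at_def
  by (rule finite_subset[OF _ finite_PiE[of "{1..deg E v}" "\<lambda>_. nbrs E v"]])
     (auto simp: locally_finite)

lemma labelings_nonempty: "labelings_at E v \<noteq> {}"
proof -
  obtain f where f: "bij_betw f {1..deg E v} (nbrs E v)"
    using finite_same_card_bij[of "{1..deg E v}" "nbrs E v"] locally_finite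
    by (auto simp: deg_def)
  then have "restrict f {1..deg E v} \<in> labelings_at E v"
    unfolding labelings_at_def mem_Collect_eq using bij_betwE[OF f]
    by (intro conjI restrict_PiE[THEN iffD2] bij_betw_cong[THEN iffD1, OF _ f]) auto
  then show ?thesis by blast
qed

abbreviation "label_pmf v \<equiv> pmf_of_set (labelings_at E v)"

lemma set_label_pmf: "set_pmf (label_pmf v) = labelings_at E v"
  by (simp add: finite_labelings labelings_nonempty)

sublocale P: product_prob_space "\<lambda>v. measure_pmf (label_pmf v)" UNIV
  by unfold_locales

sublocale M: prob_space "random_labeling E"
  unfolding random_labeling_def by (rule P.prob_space_axioms)

lemma space_labeling: "space (random_labeling E) = UNIV"
  by (simp add: random_labeling_def space_PiM)

lemma AE_labeling: "AE \<sigma> in random_labeling E. \<forall>v. \<sigma> v \<in> labelings_at E v"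
proof -
  have "AE \<sigma> in random_labeling E. \<sigma> v \<in> labelings_at E v" for v
    unfolding random_labeling_def
    by (rule P.AE_component) (auto simp: AE_measure_pmf_iff set_label_pmf)
  then show ?thesis by (simp add: AE_all_countable)
qed

lemma measurable_component:
  "(\<lambda>\<sigma>. g (\<sigma> v)) \<in> measurable (random_labeling E) (count_space UNIV)"
  unfolding random_labeling_def
  by (rule measurable_compose[OF measurable_component_singleton]) auto

lemma measurable_pos: "(\<lambda>\<sigma>. pos \<sigma> n) \<in> measurable (random_labeling E) (count_space UNIV)"
proof (induction n)
  case (Suc n)
  then show ?case
    using measurable_compose_countable[OF measurable_component Suc, of "\<lambda>v f. f (port_at n)"]
    by simp
qed simp

lemma measurable_basic_walk:
  "(\<lambda>\<sigma>. basic_walk E \<sigma> v0 l n) \<in> measurable (random_labeling E) (count_space UNIV)"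
proof (induction n)
  case 0
  show ?case using measurable_component[of "\<lambda>f. (v0, f l)" v0] by simp
next
  case (Suc n)
  have "(\<lambda>\<sigma>. (v, \<sigma> v (arc_label E \<sigma> u v mod deg E v + 1)))
      \<in> measurable (random_labeling E) (count_space UNIV)" for u v
    by (rule measurable_compose_countable[where f = "\<lambda>i \<sigma>. (v, \<sigma> v (i mod deg E v + 1))"])
       (simp_all add: arc_label_def measurable_component[where g = "\<lambda>f. (v, f i)" for i]
          measurable_component[where g = "\<lambda>f. inv_into A f v" for A])
  then have "(\<lambda>\<sigma>. (snd a, \<sigma> (snd a) (arc_label E \<sigma> (fst a) (snd a) mod deg E (snd a) + 1)))
      \<in> measurable (random_labeling E) (count_space UNIV)" for a .
  then have "(\<lambda>\<sigma>. let a = basic_walk E \<sigma> v0 l n in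
        (snd a, \<sigma> (snd a) (arc_label E \<sigma> (fst a) (snd a) mod deg E (snd a) + 1)))
      \<in> measurable (random_labeling E) (count_space UNIV)"
    unfolding Let_def by (rule measurable_compose_countable[OF _ Suc])
  then show ?case
    by (simp only: basic_walk.simps Let_def case_prod_beta)
qed

text \<open>Injectivity of \<open>\<sigma> u\<close> on the ports recovers from an arc the port
  through which it was taken, so the entering label at each step is
  \<open>port_at n\<close>.\<close>

lemma basic_walk_eq:
  assumes "\<And>v. \<sigma> v \<in> labelings_at E v"
  shows "basic_walk E \<sigma> v0 l n = (pos \<sigma> n, pos \<sigma> (Suc n))"
proof (induction n)
  case 0
  then show ?case by (simp add: port_at_0)
next
  case (Suc n)
  have "inj_on (\<sigma> u) {1..d}" for u
    using assms[of u] by (auto simp: labelings_at_def bij_betw_def regular)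
  then have "arc_label E \<sigma> (pos \<sigma> n) (pos \<sigma> (Suc n)) = port_at n"
    using port_at_range[of n] by (simp add: arc_label_def regular)
  then show ?case
    using Suc by (simp add: port_at_Suc regular)
qed

section \<open>Probabilities of cylinders\<close>

text \<open>This splits a condition on the trajectory into conditions on single vertices, the form
  that independence requires.\<close>

lemma mem_cyl_iff:
  assumes "xs \<noteq> []"
  shows "\<sigma> \<in> cyl xs \<longleftrightarrow>
    xs ! 0 = v0 \<and> (\<forall>k. Suc k < length xs \<longrightarrow> \<sigma> (xs ! k) (port_at k) = xs ! Suc k)"
    (is "_ \<longleftrightarrow> ?R")
proof
  assume "\<sigma> \<in> cyl xs"
  then have *: "pos \<sigma> k = xs ! k" if "k < length xs" for k
    using that by (simp add: cyl_def)
  show ?R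
    using *[of 0] assms * [symmetric] by (auto simp: Suc_lessD)
next
  assume R: ?R
  have "pos \<sigma> k = xs ! k" if "k < length xs" for k
    using that R by (induction k) auto
  then show "\<sigma> \<in> cyl xs" by (simp add: cyl_def)
qed

definition path_labelings :: "'a list \<Rightarrow> 'a \<Rightarrow> (nat \<Rightarrow> 'a) set" where
  "path_labelings xs v =
    {f \<in> labelings_at E v. \<forall>k. Suc k < length xs \<and> xs ! k = v \<longrightarrow> f (port_at k) = xs ! Suc k}"

text \<open>Labelings at different vertices are independent. \<open>J\<close> is left free so that a
  path and its extension can be compared over one index set; vertices never left contribute the
  factor 1.\<close>

lemma prob_cyl:
  assumes "xs \<noteq> []" "xs ! 0 = v0" "finite J" "set (butlast xs) \<subseteq> J"
  shows "M.prob (cyl xs) = (\<Prod>v\<in>J. card (path_labelings xs v) / card (labelings_at E v))"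
proof -
  let ?A = "\<lambda>v. {f. \<forall>k. Suc k < length xs \<and> xs ! k = v \<longrightarrow> f (port_at k) = xs ! Suc k}"
  have J: "xs ! k \<in> J" if "Suc k < length xs" for k
    using that assms(4) nth_mem[of k "butlast xs"] by (auto simp: nth_butlast)
  have "cyl xs = prod_emb UNIV (\<lambda>v. measure_pmf (label_pmf v)) J (Pi\<^sub>E J ?A)"
    unfolding set_eq_iff mem_cyl_iff[OF assms(1)] using assms(2) J
    by (simp add: prod_emb_def Pi_iff) blast
  then have "M.prob (cyl xs) = (\<Prod>v\<in>J. measure (measure_pmf (label_pmf v)) (?A v))"
    using P.measure_PiM_emb[of J ?A] assms(3) by (simp add: random_labeling_def)
  moreover have "measure (measure_pmf (label_pmf v)) (?A v) = card (path_labelings xs v) / card (labelings_at E v)" for v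
    by (subst measure_pmf_of_set)
       (auto simp: finite_labelings labelings_nonempty path_labelings_def Int_def
        intro!: arg_cong[where f = card])
  ultimately show ?thesis by simp
qed

text \<open>Sort the labelings compatible with \<open>xs\<close> by the port \<open>r\<close>
  leading to \<open>t\<close>. Swapping \<open>r\<close> with the port about to be used maps each of
  the \<open>d\<close> classes injectively into those compatible with
  \<open>xs @ [t]\<close>.\<close>

lemma path_labelings_card_snoc:
  assumes "xs \<noteq> []" and t: "E (last xs) t"
    and nr: "no_repeat xs"
    and new: "\<And>k. Suc k < length xs \<Longrightarrow> xs ! k = last xs \<Longrightarrow> xs ! Suc k \<noteq> t"
  shows "card (path_labelings xs (last xs)) \<le> d * card (path_labelings (xs @ [t]) (last xs))"
proof -
  define w where "w = last xs"
  define p where "p = port_at (length xs - 1)"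
  define A where "A = path_labelings xs w"
  define A' where "A' = path_labelings (xs @ [t]) w"
  have p: "p \<in> {1..d}" by (simp only: p_def port_at_range)
  have last: "xs ! (length xs - 1) = w" using \<open>xs \<noteq> []\<close> by (simp add: w_def last_conv_nth)
  have unused: "port_at k \<noteq> p" if "Suc k < length xs" "xs ! k = w" for k
    using nr that last unfolding no_repeat_def p_def inj_on_def by fastforce
  have A'I: "f \<in> A'" if "f \<in> A" "f p = t" for f
  proof -
    have "f (port_at k) = (xs @ [t]) ! Suc k" if "Suc k < length (xs @ [t])" "(xs @ [t]) ! k = w" for k
    proof (cases "Suc k < length xs")
      case True
      then show ?thesis using that \<open>f \<in> A\<close> by (simp add: A_def path_labelings_def nth_append)
    next
      case False
      then have "length xs = Suc k" using that by simp
      then show ?thesis using \<open>f p = t\<close> by (simp add: p_def nth_append)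
    qed
    then show ?thesis using that by (simp add: A_def A'_def path_labelings_def)
  qed
  have fin: "finite A'"
    unfolding A'_def path_labelings_def using finite_labelings[of w] by simp
  have "A \<subseteq> (\<Union>r\<in>{1..d}. {f \<in> A. f r = t})"
  proof
    fix f assume f: "f \<in> A"
    then have "f ` {1..d} = nbrs E w"
      by (simp add: A_def path_labelings_def labelings_at_def bij_betw_def regular)
    moreover have "t \<in> nbrs E w" using t by (simp add: nbrs_def w_def)
    ultimately show "f \<in> (\<Union>r\<in>{1..d}. {f \<in> A. f r = t})" using f by force
  qed
  moreover have le: "card {f \<in> A. f r = t} \<le> card A' \<and> finite {f \<in> A. f r = t}" if r: "r \<in> {1..d}" for r
  proof -
    \<comment> \<open>Exchanging the ports \<open>p\<close> and \<open>r\<close> keeps the constraints of \<open>xs\<close>, as neither is used by it.\<close>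
    define g :: "(nat \<Rightarrow> 'a) \<Rightarrow> nat \<Rightarrow> 'a" where "g f = f \<circ> Transposition.transpose p r" for f
    have inj: "inj_on g {f \<in> A. f r = t}"
      by (rule inj_on_inverseI[of _ g]) (simp add: g_def comp_assoc)
    have sub: "g ` {f \<in> A. f r = t} \<subseteq> A'"
    proof safe
      fix f assume f: "f \<in> A" "t = f r"
      have L: "f \<in> labelings_at E w" using f by (simp add: A_def path_labelings_def)
      have perm: "bij_betw (Transposition.transpose p r) {1..d} {1..d}"
        using p r by (intro bij_betw_byWitness[where f' = "Transposition.transpose p r"])
          (auto simp: Transposition.transpose_def)
      have "bij_betw (g f) {1..d} (nbrs E w)"
        unfolding g_def using bij_betw_trans[OF perm] L by (auto simp: labelings_at_def regular)
      \<comment> \<open>Both \<open>p\<close> and \<open>r\<close> lie in \<open>{1..d}\<close>, so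
        the swap preserves the default value \<open>undefined\<close> outside.\<close>
      moreover have "g f \<in> {1..d} \<rightarrow>\<^sub>E nbrs E w"
      proof (rule PiE_I)
        fix i assume "i \<notin> {1..d}"
        then have "Transposition.transpose p r i = i" "f i = undefined"
          using L p r by (auto simp: Transposition.transpose_def labelings_at_def regular)
        then show "g f i = undefined" by (simp add: g_def)
      qed (use bij_betwE[OF calculation] in blast)
      ultimately have "g f \<in> labelings_at E w"
        by (simp add: labelings_at_def regular)
      moreover have "g f (port_at k) = xs ! Suc k" if k: "Suc k < length xs" "xs ! k = w" for k
      proof -
        have *: "f (port_at k) = xs ! Suc k" using f k by (simp add: A_def path_labelings_def)
        \<comment> \<open>Port \<open>r\<close> leads to \<open>t\<close>, but by \<open>new\<close>
          no step of \<open>xs\<close> goes from \<open>w\<close> to \<open>t\<close>.\<close>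
        then have "port_at k \<noteq> r" using new[OF k(1)] k f(2) w_def by auto
        then show ?thesis using unused[OF k] * by (simp add: g_def Transposition.transpose_def)
      qed
      ultimately have "g f \<in> A" by (simp add: A_def path_labelings_def)
      moreover have "g f p = t" using f by (simp add: g_def)
      ultimately show "g f \<in> A'" by (rule A'I)
    qed
    show ?thesis
      using card_inj_on_le[OF inj sub fin] inj_on_finite[OF inj sub fin] by blast
  qed
  ultimately have "card A \<le> card (\<Union>r\<in>{1..d}. {f \<in> A. f r = t})"
    by (intro card_mono) auto
  also have "\<dots> \<le> (\<Sum>r\<in>{1..d}. card {f \<in> A. f r = t})"
    by (rule card_UN_le) simp
  also have "\<dots> \<le> (\<Sum>r\<in>{1..d}. card A')"
    using le by (intro sum_mono) auto
  finally show ?thesis by (simp add: A_def A'_def w_def)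
qed

text \<open>In the product formula only the factor at the last vertex changes, and it shrinks at
  most by the factor \<open>d\<close>.\<close>

lemma prob_cyl_snoc:
  assumes "xs \<noteq> []" and t: "E (last xs) t"
    and nr: "no_repeat xs"
    and new: "\<And>k. Suc k < length xs \<Longrightarrow> xs ! k = last xs \<Longrightarrow> xs ! Suc k \<noteq> t"
  shows "M.prob (cyl xs) \<le> d * M.prob (cyl (xs @ [t]))"
proof (cases "xs ! 0 = v0")
  case False
  then have "cyl xs = {}" using assms(1) mem_cyl_iff[of xs] by blast
  then show ?thesis by simp
next
  case True
  define w where "w = last xs"
  let ?J = "set xs - {w}"
  let ?r = "\<lambda>ys v. card (path_labelings ys v) / card (labelings_at E v)"
  have w: "w \<in> set xs" using assms(1) by (simp add: w_def)
  have eq: "path_labelings (xs @ [t]) v = path_labelings xs v" if "v \<in> ?J" for v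
  proof -
    have "(\<exists>k. k < length xs \<and> xs ! k = v \<and> \<not> Suc k < length xs) \<longleftrightarrow> False"
      using that assms(1) by (auto simp: w_def last_conv_nth dest!: not_less_eq[THEN iffD1])
        (metis One_nat_def Suc_lessI diff_Suc_1)
    then show ?thesis
      by (auto simp: path_labelings_def nth_append)
  qed
  have 1: "M.prob (cyl xs) = ?r xs w * (\<Prod>v\<in>?J. ?r xs v)"
    using prob_cyl[OF assms(1) True, of "set xs"] w prod.remove[of "set xs" w "?r xs"]
    by (simp add: subsetI in_set_butlastD)
  have 2: "M.prob (cyl (xs @ [t])) = ?r (xs @ [t]) w * (\<Prod>v\<in>?J. ?r xs v)"
    using prob_cyl[of "xs @ [t]" "set xs"] assms(1) True w
      prod.remove[of "set xs" w "?r (xs @ [t])"] eq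
    by (simp add: nth_append)
  have "?r xs w \<le> d * ?r (xs @ [t]) w"
    using path_labelings_card_snoc[OF assms, folded w_def]
    by (auto simp: divide_simps simp flip: of_nat_mult intro!: divide_right_mono)
  then have "?r xs w * (\<Prod>v\<in>?J. ?r xs v) \<le> (d * ?r (xs @ [t]) w) * (\<Prod>v\<in>?J. ?r xs v)"
    by (intro mult_right_mono prod_nonneg) auto
  then show ?thesis unfolding 1 2 by (simp add: mult.assoc)
qed

section \<open>Forcing a repetition by excursions around a vertex\<close>

text \<open>Here \<open>n\<close> is the time of the first visit to \<open>x\<close>, and \<open>xs\<close> is the history after some
  excursions \<open>x, w, x\<close>. The condition on \<open>port_at (Suc k)\<close> says that the port of \<open>x\<close> reserved for
  \<open>y\<close> is still unused.\<close>

lemma star_extension: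
  assumes "n < length xs" "0 < n" "last xs = x" "no_repeat xs" "E x y" "xs ! (n - 1) = y"
    and into: "\<And>k. Suc k < length xs \<Longrightarrow> xs ! Suc k = x \<Longrightarrow> Suc k = n \<or> (\<exists>j. k = Suc j \<and> xs ! j = x)"
    and out: "\<And>k. Suc k < length xs \<Longrightarrow> xs ! k = x \<Longrightarrow>
      xs ! Suc k \<noteq> y \<and> port_at (Suc k) \<noteq> port_at (n - 1)"
    and "d \<le> card {k. Suc k < length xs \<and> xs ! k = x} + m"
  shows "\<exists>zs. length zs \<le> 2 * m \<and> \<not> no_repeat (xs @ zs) \<and>
    M.prob (cyl xs) \<le> d ^ length zs * M.prob (cyl (xs @ zs))"
  using assms
proof (induction m arbitrary: xs)
  case (0 xs)
  \<comment> \<open>This case is contradictory: \<open>d\<close> departures from \<open>x\<close>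
    and the current visit would give more than \<open>d\<close> visits with distinct ports.\<close>
  define U where "U = {k. Suc k < length xs \<and> xs ! k = x}"
  define U' where "U' = {k. k < length xs \<and> xs ! k = x}"
  have "xs \<noteq> []" using "0.prems"(1) by auto
  then have "xs ! (length xs - 1) = x"
    using last_conv_nth[of xs] unfolding "0.prems"(3) by simp
  then have "length xs - 1 \<in> U'" "length xs - 1 \<notin> U" "U \<subseteq> U'"
    using \<open>xs \<noteq> []\<close> by (auto simp: U_def U'_def)
  then have "U \<subset> U'" by blast
  moreover have "finite U'" by (simp add: U'_def)
  ultimately have "card U < card U'" by (intro psubset_card_mono)
  moreover have "inj_on port_at U'"
    using "0.prems"(4) by (auto simp: no_repeat_def U'_def inj_on_def)
  then have "card U' \<le> d"
    using card_inj_on_le[of port_at U' "{1..d}"] port_at_range by fastforce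
  ultimately show ?case using "0.prems"(9) by (simp add: U_def)
next
  case (Suc m xs)
  note out = Suc.prems(8)
  define N where "N = length xs"
  define U where "U = {k. Suc k < N \<and> xs ! k = x}"
  define U' where "U' = {k. k < N \<and> xs ! k = x}"
  have xs: "xs \<noteq> []" "0 < N"
    using Suc.prems(1) by (auto simp: N_def)
  then have last: "xs ! (N - 1) = x"
    using last_conv_nth[of xs] unfolding Suc.prems(3) N_def by simp
  have fin: "finite U'" by (simp add: U'_def)
  have "U \<subseteq> U'" by (auto simp: U_def U'_def)
  with fin have fin: "finite U" "finite U'" by (auto intro: finite_subset)
  have U': "U' = insert (N - 1) U" "N - 1 \<notin> U"
    using xs last by (auto simp: U_def U'_def)
  show ?case
  proof (cases "port_at N = port_at (n - 1)")
    case True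
    \<comment> \<open>Index \<open>N\<close> is the next time, so being at \<open>y\<close> then
      repeats the pair of time \<open>n - 1\<close>.\<close>
    have "M.prob (cyl xs) \<le> d * M.prob (cyl (xs @ [y]))"
      using Suc.prems by (intro prob_cyl_snoc xs) auto
    moreover have "\<not> no_repeat (xs @ [y])"
    proof
      assume "no_repeat (xs @ [y])"
      then have "n - 1 = N"
        unfolding no_repeat_def
        by (rule inj_onD) (use Suc.prems(1,2,6) True in \<open>auto simp: N_def nth_append\<close>)
      then show False using Suc.prems(1) by (simp add: N_def)
    qed
    ultimately show ?thesis by (intro exI[of _ "[y]"]) auto
  next
    case False
    have nxt: "port_at (Suc k) \<noteq> port_at (n - 1)" if "k \<in> U'" for k
      using that False out xs(2) by (auto simp: U' U_def N_def)
    \<comment> \<open>The cyclic predecessor of \<open>port_at (n - 1)\<close>; adding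
      \<open>d - 1\<close> avoids truncated subtraction when \<open>n = 1\<close>.\<close>
    define p where "p = port_at (n - 1 + (d - 1))"
    have "port_at k \<noteq> p" if "k \<in> U'" for k
    proof
      assume "port_at k = p"
      then have "port_at (Suc k) = port_at (Suc (n - 1 + (d - 1)))"
        by (simp only: port_at_Suc p_def)
      also have "Suc (n - 1 + (d - 1)) = n - 1 + d" using d_pos by simp
      finally show False using nxt[OF that] by (simp only: port_at_add_d)
    qed
    then have "port_at ` U' \<subseteq> {1..d} - {p}"
      using port_at_range by blast
    moreover have "inj_on port_at U'"
      using Suc.prems(4) by (auto simp: no_repeat_def U'_def inj_on_def N_def)
    ultimately have "card U' \<le> card ({1..d} - {p})"
      by (intro card_inj_on_le) auto
    also have "\<dots> = d - 1"
      using port_at_range[of "n - 1 + (d - 1)", folded p_def] by simp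
    \<comment> \<open>The current visit and the reserved port \<open>p\<close> take up two of the
      \<open>d\<close> ports, so the earlier targets together with \<open>y\<close> cannot exhaust
      the \<open>d\<close> neighbours.\<close>
    finally have "Suc (card U) \<le> d - 1" using U' fin by simp
    moreover have "card (insert y ((\<lambda>k. xs ! Suc k) ` U)) \<le> Suc (card U)"
      using fin card_image_le[of U "\<lambda>k. xs ! Suc k"] by (simp add: card_insert_if)
    moreover have "card (nbrs E x) = d" using regular[of x] by (simp add: deg_def)
    ultimately have "card (insert y ((\<lambda>k. xs ! Suc k) ` U)) < card (nbrs E x)"
      using d_pos by linarith
    then have "\<not> nbrs E x \<subseteq> insert y ((\<lambda>k. xs ! Suc k) ` U)"
      using fin card_mono[of "insert y ((\<lambda>k. xs ! Suc k) ` U)" "nbrs E x"] by fastforce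
    then obtain w where w: "E x w" "w \<noteq> y" "w \<notin> (\<lambda>k. xs ! Suc k) ` U"
      by (auto simp: nbrs_def)
    have "w \<noteq> x" using w(1) irrefl by auto
    have step1: "M.prob (cyl xs) \<le> d * M.prob (cyl (xs @ [w]))"
      using Suc.prems w by (intro prob_cyl_snoc xs) (auto simp: U_def N_def)
    show ?thesis
    proof (cases "no_repeat (xs @ [w])")
      case False
      with step1 show ?thesis by (intro exI[of _ "[w]"]) auto
    next
      case nr1: True
      \<comment> \<open>The return step is free: by \<open>into\<close>, an earlier step from
        \<open>w\<close> to \<open>x\<close> is either the first entry, which came from
        \<open>y\<close>, or the end of an excursion that had left \<open>x\<close> for
        \<open>w\<close>, against the choice of \<open>w\<close>.\<close>
      have "(xs @ [w]) ! Suc k \<noteq> x" if k: "Suc k < length (xs @ [w])" "(xs @ [w]) ! k = w" for k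
      proof
        assume "(xs @ [w]) ! Suc k = x"
        then have "Suc k \<noteq> length xs" using \<open>w \<noteq> x\<close> by auto
        then have "Suc k < length xs" using k(1) by simp
        with k \<open>(xs @ [w]) ! Suc k = x\<close>
        have *: "Suc k < length xs" "xs ! Suc k = x" "xs ! k = w"
          by (simp_all add: nth_append)
        from Suc.prems(7)[OF *(1,2)] show False
          using * w Suc.prems(6) by (auto simp: U_def N_def image_iff)
      qed
      then have "M.prob (cyl (xs @ [w])) \<le> d * M.prob (cyl ((xs @ [w]) @ [x]))"
        using nr1 w(1) by (intro prob_cyl_snoc) (auto intro: sym)
      then have "d * M.prob (cyl (xs @ [w])) \<le> d * (d * M.prob (cyl (xs @ [w, x])))"
        by (intro mult_left_mono) auto
      with step1 have step2: "M.prob (cyl xs) \<le> d ^ 2 * M.prob (cyl (xs @ [w, x]))"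
        by (simp add: power2_eq_square)
      show ?thesis
      proof (cases "no_repeat (xs @ [w, x])")
        case False
        with step2 show ?thesis by (intro exI[of _ "[w, x]"]) (auto simp: power2_eq_square)
      next
        case nr2: True
        define ys where "ys = xs @ [w, x]"
        have nth: "ys ! k = (if k < N then xs ! k else if k = N then w else x)"
          if "k < N + 2" for k
          using that by (auto simp: ys_def nth_append N_def nth_Cons split: nat.splits)
        have len: "length ys = N + 2" by (simp add: ys_def N_def)
        \<comment> \<open>The visit at time \<open>N - 1\<close> has become a departure, so the
          count grows by one and \<open>m\<close> may drop by one.\<close>
        have "{k. Suc k < length ys \<and> ys ! k = x} = U'"
          unfolding len U'_def using \<open>w \<noteq> x\<close> by (auto simp: nth split: if_splits)
        then have card: "d \<le> card {k. Suc k < length ys \<and> ys ! k = x} + m"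
          using Suc.prems(9) U' fin by (simp add: U_def N_def)
        have "\<exists>zs. length zs \<le> 2 * m \<and> \<not> no_repeat (ys @ zs) \<and>
            M.prob (cyl ys) \<le> d ^ length zs * M.prob (cyl (ys @ zs))"
        proof (rule Suc.IH)
          fix k assume k: "Suc k < length ys" "ys ! Suc k = x"
          show "Suc k = n \<or> (\<exists>j. k = Suc j \<and> ys ! j = x)"
          proof (cases "Suc k < N")
            case True
            then have "xs ! Suc k = x" using k by (simp add: nth)
            from Suc.prems(7)[OF _ this] True show ?thesis
              by (auto simp: nth N_def)
          next
            case False
            then have "k = N" using k \<open>w \<noteq> x\<close> by (auto simp: nth len split: if_splits)
            then show ?thesis using xs last by (intro disjI2 exI[of _ "N - 1"]) (auto simp: nth)
          qed
        next
          fix k assume k: "Suc k < length ys" "ys ! k = x"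
          then have "k \<in> U'"
            unfolding U'_def using \<open>w \<noteq> x\<close> by (auto simp: nth len split: if_splits)
          moreover have "ys ! Suc k \<noteq> y"
            using \<open>k \<in> U'\<close> out[of k] w(2) xs(2) by (auto simp: U' U_def nth N_def[symmetric])
          ultimately show "ys ! Suc k \<noteq> y \<and> port_at (Suc k) \<noteq> port_at (n - 1)"
            using nxt by blast
        qed (use Suc.prems nr2 card in \<open>auto simp: ys_def nth_append\<close>)
        then obtain zs where zs: "length zs \<le> 2 * m" "\<not> no_repeat (ys @ zs)"
          "M.prob (cyl ys) \<le> d ^ length zs * M.prob (cyl (ys @ zs))" by blast
        have "d ^ 2 * M.prob (cyl ys) \<le> d ^ 2 * (d ^ length zs * M.prob (cyl (ys @ zs)))"
          using zs(3) by (intro mult_left_mono) auto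
        with step2 zs(1,2) show ?thesis
          by (intro exI[of _ "[w, x] @ zs"]) (auto simp: ys_def power2_eq_square algebra_simps)
      qed
    qed
  qed
qed

section \<open>Histories and first visits\<close>

lemma length_history [simp]: "length (history \<sigma> n) = Suc n"
  by (simp add: history_def)

lemma nth_history [simp]: "k \<le> n \<Longrightarrow> history \<sigma> n ! k = pos \<sigma> k"
  unfolding history_def by (subst nth_map) (auto simp del: upt_Suc)

text \<open>Cylinders of one length are fibres of \<open>history\<close>, hence disjoint for
  distinct lists.\<close>

lemma mem_cyl_history: "length xs = Suc n \<Longrightarrow> \<sigma> \<in> cyl xs \<longleftrightarrow> history \<sigma> n = xs"
  by (auto simp: cyl_def list_eq_iff_nth_eq less_Suc_eq_le)

lemma cyl_measurable: "cyl xs \<in> sets (random_labeling E)"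
proof -
  have "{\<sigma> \<in> space (random_labeling E). pos \<sigma> k = v} \<in> sets (random_labeling E)" for k v
    using measurable_sets[OF measurable_pos, of "{v}" k] by (simp add: space_labeling vimage_def)
  then have "{\<sigma> \<in> space (random_labeling E). \<forall>k\<in>{..<length xs}. pos \<sigma> k = xs ! k}
      \<in> sets (random_labeling E)"
    by (intro sets.sets_Collect_finite_All) auto
  then show ?thesis by (simp add: cyl_def space_labeling lessThan_def)
qed

lemma history_measurable:
  "(\<lambda>\<sigma>. history \<sigma> n) \<in> measurable (random_labeling E) (count_space UNIV)"
proof -
  have "(\<lambda>\<sigma>. history \<sigma> n) -` {xs} \<in> sets (random_labeling E)" for xs
  proof (cases "length xs = Suc n")
    case True
    then have "(\<lambda>\<sigma>. history \<sigma> n) -` {xs} = cyl xs"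
      by (auto simp: mem_cyl_history)
    then show ?thesis using cyl_measurable by simp
  next
    case False
    then have "(\<lambda>\<sigma>. history \<sigma> n) -` {xs} = {}" by auto
    then show ?thesis by simp
  qed
  then show ?thesis
    by (subst measurable_count_space_eq2_countable) (auto simp: space_labeling)
qed

lemma history_sets: "{\<sigma>. Q (history \<sigma> n)} \<in> sets (random_labeling E)"
  using measurable_sets[OF history_measurable, of "Collect Q" n]
  by (simp add: space_labeling vimage_def)

lemma no_repeat_history_iff:
  "no_repeat (history \<sigma> n) \<longleftrightarrow> inj_on (\<lambda>k. (pos \<sigma> k, port_at k)) {..n}"
  unfolding no_repeat_def length_history lessThan_Suc_atMost
  by (rule inj_on_cong) simp

lemma cyl_extension_repeats:
  assumes "\<not> no_repeat ys" "\<sigma> \<in> cyl ys" "length ys \<le> Suc n"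
  shows "\<not> no_repeat (history \<sigma> n)"
proof
  assume "no_repeat (history \<sigma> n)"
  then have "inj_on (\<lambda>k. (pos \<sigma> k, port_at k)) {..<length ys}"
    unfolding no_repeat_history_iff using assms(3) by (auto elim: inj_on_subset)
  then have "no_repeat ys"
    unfolding no_repeat_def using assms(2)
    by (subst inj_on_cong[where g = "\<lambda>k. (pos \<sigma> k, port_at k)"]) (auto simp: cyl_def)
  then show False using assms(1) by simp
qed

text \<open>Histories with a repetition are excluded so that each first visit can be charged to a
  first repetition still to come.\<close>

definition first_visit :: "'a list \<Rightarrow> bool" where
  "first_visit xs \<longleftrightarrow> no_repeat xs \<and> last xs \<notin> set (butlast xs)"

text \<open>Since \<open>x\<close> has not been left yet, \<open>star_extension\<close> applies with
  \<open>m = d\<close>; its continuation stays within the window of \<open>2 * d\<close>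
  steps.\<close>

lemma prob_repeat_soon:
  assumes "0 < n" "length xs = Suc n" "first_visit xs"
  shows "M.prob (cyl xs) \<le> d ^ (2 * d) *
    M.prob (cyl xs \<inter> {\<sigma>. \<not> no_repeat (history \<sigma> (n + 2 * d))})"
    (is "_ \<le> _ * M.prob (_ \<inter> ?R)")
proof (cases "M.prob (cyl xs) = 0")
  case True
  then show ?thesis by simp
next
  case False
  define x where "x = last xs"
  define y where "y = xs ! (n - 1)"
  have nr: "no_repeat xs" and "x \<notin> set (butlast xs)"
    using assms(3) by (auto simp: first_visit_def x_def)
  then have new: "xs ! k \<noteq> x" if "k < n" for k
    using that assms(2) nth_mem[of k "butlast xs"] by (auto simp: nth_butlast)
  have xn: "xs ! n = x"
    using assms(2) last_conv_nth[of xs] by (cases xs) (auto simp: x_def)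
  \<comment> \<open>Positive probability yields a genuine labeling that realises \<open>xs\<close>;
    it is used to see that \<open>x\<close> and \<open>y\<close> are adjacent.\<close>
  have "\<exists>\<sigma>\<in>cyl xs. \<forall>v. \<sigma> v \<in> labelings_at E v"
  proof (rule ccontr)
    assume *: "\<not> ?thesis"
    have "AE \<sigma> in random_labeling E. \<sigma> \<notin> cyl xs"
      using AE_labeling by eventually_elim (use * in blast)
    then have "M.prob (cyl xs) = 0"
      using M.prob_eq_0[OF cyl_measurable] by simp
    then show False using False by simp
  qed
  then obtain \<sigma> where \<sigma>: "\<sigma> \<in> cyl xs" "\<And>v. \<sigma> v \<in> labelings_at E v" by blast
  have "pos \<sigma> n = x" "pos \<sigma> (n - 1) = y"
    using \<sigma>(1) assms(2) xn by (auto simp: cyl_def y_def)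
  then have "x = \<sigma> y (port_at (n - 1))"
    using assms(1) by (cases n) auto
  moreover have "\<sigma> y (port_at (n - 1)) \<in> nbrs E y"
    using \<sigma>(2)[of y] port_at_range[of "n - 1"]
    by (auto simp: labelings_at_def regular dest!: bij_betwE)
  ultimately have "E x y" by (auto simp: nbrs_def intro: sym)
  have "\<exists>zs. length zs \<le> 2 * d \<and> \<not> no_repeat (xs @ zs) \<and>
    M.prob (cyl xs) \<le> d ^ length zs * M.prob (cyl (xs @ zs))"
  proof (rule star_extension[where n = n and x = x and y = y])
    fix k assume "Suc k < length xs" "xs ! Suc k = x"
    then show "Suc k = n \<or> (\<exists>j. k = Suc j \<and> xs ! j = x)"
      using new[of "Suc k"] assms(2) by (cases "Suc k = n") auto
  next
    fix k assume "Suc k < length xs" "xs ! k = x"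
    then show "xs ! Suc k \<noteq> y \<and> port_at (Suc k) \<noteq> port_at (n - 1)"
      using new[of k] assms(2) by auto
  qed (use assms nr \<open>E x y\<close> in \<open>auto simp: x_def y_def\<close>)
  then obtain zs where zs: "length zs \<le> 2 * d" "\<not> no_repeat (xs @ zs)"
    "M.prob (cyl xs) \<le> d ^ length zs * M.prob (cyl (xs @ zs))" by blast
  have "cyl (xs @ zs) \<subseteq> cyl xs"
    unfolding cyl_def by (auto simp: nth_append)
  moreover have "cyl (xs @ zs) \<subseteq> ?R"
    using cyl_extension_repeats[OF zs(2), of _ "n + 2 * d"] zs(1) assms(2) by auto
  ultimately have "M.prob (cyl (xs @ zs)) \<le> M.prob (cyl xs \<inter> ?R)"
    by (intro M.finite_measure_mono sets.Int cyl_measurable history_sets) auto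
  moreover have "real (d ^ length zs) \<le> real (d ^ (2 * d))"
    using zs(1) d_pos by (intro of_nat_mono power_increasing) auto
  ultimately have "d ^ length zs * M.prob (cyl (xs @ zs)) \<le> d ^ (2 * d) * M.prob (cyl xs \<inter> ?R)"
    by (intro mult_mono) auto
  with zs(3) show ?thesis by linarith
qed

text \<open>Sum the bound for single histories. No repetition at time \<open>n\<close> but one by
  \<open>n + 2 * d\<close> is a difference of nested events, which gives the difference of
  probabilities.\<close>

lemma prob_first_visit_le:
  assumes "0 < n"
  shows "M.prob {\<sigma>. first_visit (history \<sigma> n)} \<le> d ^ (2 * d) *
    (M.prob {\<sigma>. no_repeat (history \<sigma> n)} - M.prob {\<sigma>. no_repeat (history \<sigma> (n + 2 * d))})"
proof -
  define I where "I = {xs. length xs = Suc n \<and> first_visit xs}"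
  define R where "R = {\<sigma>. \<not> no_repeat (history \<sigma> (n + 2 * d))}"
  define D where "D = ennreal (d ^ (2 * d))"
  let ?M = "random_labeling E"
  have R: "R \<in> sets ?M" unfolding R_def by (rule history_sets)
  have B: "{\<sigma>. first_visit (history \<sigma> n)} = (\<Union>xs\<in>I. cyl xs)"
    by (auto simp: I_def mem_cyl_history)
  have disj: "disjoint_family_on cyl I"
    by (auto simp: disjoint_family_on_def I_def mem_cyl_history)
  have le: "emeasure ?M (cyl xs) \<le> D * emeasure ?M (cyl xs \<inter> R)" if "xs \<in> I" for xs
    using prob_repeat_soon[OF assms, of xs] that
    unfolding M.emeasure_eq_measure D_def R_def I_def
    by (simp add: ennreal_leI flip: ennreal_mult)
  \<comment> \<open>There are countably many lists, so the sum over disjoint cylinders is an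
    integral over \<open>count_space I\<close>.\<close>
  have "emeasure ?M {\<sigma>. first_visit (history \<sigma> n)}
      = (\<integral>\<^sup>+xs. emeasure ?M (cyl xs) \<partial>count_space I)"
    unfolding B by (rule emeasure_UN_countable) (auto simp: cyl_measurable disj)
  also have "\<dots> \<le> (\<integral>\<^sup>+xs. D * emeasure ?M (cyl xs \<inter> R) \<partial>count_space I)"
    by (intro nn_integral_mono) (simp add: le)
  also have "\<dots> = D * (\<integral>\<^sup>+xs. emeasure ?M (cyl xs \<inter> R) \<partial>count_space I)"
    by (rule nn_integral_cmult) simp
  also have "(\<integral>\<^sup>+xs. emeasure ?M (cyl xs \<inter> R) \<partial>count_space I)
      = emeasure ?M (\<Union>xs\<in>I. cyl xs \<inter> R)"
    using disj R by (intro emeasure_UN_countable[symmetric])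
      (auto simp: cyl_measurable disjoint_family_on_def)
  also have "(\<Union>xs\<in>I. cyl xs \<inter> R) = {\<sigma>. first_visit (history \<sigma> n)} \<inter> R"
    unfolding B by blast
  finally have "M.prob {\<sigma>. first_visit (history \<sigma> n)} \<le>
      d ^ (2 * d) * M.prob ({\<sigma>. first_visit (history \<sigma> n)} \<inter> R)"
    unfolding D_def M.emeasure_eq_measure by (simp flip: ennreal_mult)
  also have "M.prob ({\<sigma>. first_visit (history \<sigma> n)} \<inter> R) \<le>
      M.prob ({\<sigma>. no_repeat (history \<sigma> n)} - {\<sigma>. no_repeat (history \<sigma> (n + 2 * d))})"
    by (intro M.finite_measure_mono sets.Diff history_sets) (auto simp: first_visit_def R_def)
  also have "\<dots> = M.prob {\<sigma>. no_repeat (history \<sigma> n)} - M.prob {\<sigma>. no_repeat (history \<sigma> (n + 2 * d))}"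
    by (intro M.finite_measure_Diff history_sets)
       (auto simp: no_repeat_history_iff elim: inj_on_subset)
  finally show ?thesis by (simp add: mult_left_mono)
qed

section \<open>Borel-Cantelli and the conclusion\<close>

lemma AE_finitely_many_first_visits:
  "AE \<sigma> in random_labeling E. eventually (\<lambda>n. \<not> first_visit (history \<sigma> n)) sequentially"
proof -
  define a where "a n = M.prob {\<sigma>. no_repeat (history \<sigma> n)}" for n
  have "decseq a"
    unfolding decseq_def a_def
    by (intro allI impI M.finite_measure_mono history_sets)
       (auto simp: no_repeat_history_iff elim!: inj_on_subset)
  then have "summable (\<lambda>n. d ^ (2 * d) * (a n - a (n + 2 * d)))"
    by (intro summable_mult summable_diff_shift) (simp, simp add: a_def)
  \<comment> \<open>The comparison starts at 1 because a first visit at time 0 has no preceding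
    vertex \<open>y\<close>.\<close>
  then have "summable (\<lambda>n. M.prob {\<sigma>. first_visit (history \<sigma> n)})"
    by (rule summable_comparison_test'[where N = 1])
       (use prob_first_visit_le in \<open>simp add: a_def\<close>)
  then have "AE \<sigma> in random_labeling E. eventually
      (\<lambda>n. \<sigma> \<in> space (random_labeling E) - {\<sigma>. first_visit (history \<sigma> n)}) sequentially"
    by (intro borel_cantelli_AE1 history_sets) (auto simp: M.emeasure_eq_measure)
  then show ?thesis by (simp add: space_labeling)
qed

text \<open>Once no new vertex appears, the walk stays in a finite set, leaving only finitely many
  pairs (vertex, port).\<close>

lemma transient_first_visits:
  assumes inj: "inj (\<lambda>k. (pos \<sigma> k, port_at k))"
    and ev: "eventually (\<lambda>n. \<not> first_visit (history \<sigma> n)) sequentially"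
  shows False
proof -
  have nr: "no_repeat (history \<sigma> n)" for n
    unfolding no_repeat_history_iff using inj by (rule inj_on_subset) simp
  obtain N where N: "\<not> first_visit (history \<sigma> n)" if "n \<ge> N" for n
    using ev by (auto simp: eventually_sequentially)
  have old: "pos \<sigma> n \<in> pos \<sigma> ` {..<n}" if "n \<ge> N" for n
    using N[OF that] nr by (auto simp: first_visit_def history_def)
  have "pos \<sigma> n \<in> pos \<sigma> ` {..N}" for n
  proof (induction n rule: less_induct)
    case (less n)
    then show ?case using old[of n] by (cases "n \<le> N") auto
  qed
  then have "range (\<lambda>k. (pos \<sigma> k, port_at k)) \<subseteq> pos \<sigma> ` {..N} \<times> {1..d}"
    using port_at_range by auto
  then have "finite (range (\<lambda>k. (pos \<sigma> k, port_at k)))"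
    by (rule finite_subset) auto
  with inj show False using finite_imageD infinite_UNIV_nat by blast
qed

lemma AE_walk_cycles: "AE \<sigma> in random_labeling E. walk_cycles E \<sigma> v0 l"
  using AE_finitely_many_first_visits AE_labeling
proof eventually_elim
  case (elim \<sigma>)
  then have "\<not> inj (\<lambda>k. (pos \<sigma> k, port_at k))"
    using transient_first_visits by blast
  then obtain m n where mn: "m < n" "pos \<sigma> m = pos \<sigma> n" "port_at m = port_at n"
    unfolding inj_def by (metis (no_types, lifting) Pair_inject linorder_neqE_nat)
  \<comment> \<open>Equal vertex and port determine the same next vertex, hence the same
    arc.\<close>
  then have "basic_walk E \<sigma> v0 l m = basic_walk E \<sigma> v0 l n"
    using elim by (simp add: basic_walk_eq)
  then show ?case using mn(1) by (auto simp: walk_cycles_def)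
qed

text \<open>Needed to turn the almost sure statement into one on the measure of the event, a
  countable union over pairs of times and arcs.\<close>

lemma walk_cycles_measurable:
  "{\<sigma> \<in> space (random_labeling E). walk_cycles E \<sigma> v0 l} \<in> sets (random_labeling E)"
proof -
  have "{\<sigma> \<in> space (random_labeling E). walk_cycles E \<sigma> v0 l} =
      (\<Union>n. \<Union>m\<in>{..<n}. \<Union>a.
        ((\<lambda>\<sigma>. basic_walk E \<sigma> v0 l m) -` {a} \<inter> space (random_labeling E)) \<inter>
        ((\<lambda>\<sigma>. basic_walk E \<sigma> v0 l n) -` {a} \<inter> space (random_labeling E)))"
    unfolding walk_cycles_def by (auto, metis)
  also have "\<dots> \<in> sets (random_labeling E)"
    by (intro sets.countable_UN'' sets.Int measurable_sets[OF measurable_basic_walk]) auto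
  finally show ?thesis .
qed

end

theorem theorem4p4:
  fixes E :: "'a::countable \<Rightarrow> 'a \<Rightarrow> bool" and d :: nat and v0 :: 'a and l :: nat
  assumes sym: "\<And>v w. E v w \<Longrightarrow> E w v"
    and irrefl: "\<And>v. \<not> E v v"
    and infinite: "infinite (UNIV :: 'a set)"
    and connected: "\<And>v w. E\<^sup>*\<^sup>* v w"
    and locally_finite: "\<And>v. finite (nbrs E v)"
    and regular: "\<And>v. deg E v = d"
    and port: "l \<in> {1..d}"
  shows "measure (random_labeling E)
           {\<sigma> \<in> space (random_labeling E). walk_cycles E \<sigma> v0 l} = 1"
proof -
  interpret regular_graph_walk E d v0 l
    using sym irrefl locally_finite regular port by unfold_locales
  show ?thesis
    by (subst M.prob_Collect_eq_1) (auto intro: walk_cycles_measurable AE_walk_cycles)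
qed

end
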